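(* For any triangle-free graph $G$ of order $n$, $$\chi_{2}^{f}(G)\leq \Big\lfloor\dfrac{n-\alpha_2^{f}(G)+4}{2}\Big\rfloor,$$ and this bound is sharp, i.e., equality is attained by some triangle-free graph.
   Context: All graphs are finite and simple. A set $S\subseteq V(G)$ is a $2$-frugal independent set of $G$ if $S$ is independent and every vertex of $G$ has at most $2$ neighbors in $S$; $\alpha_2^f(G)$ is the maximum cardinality of such a set. A $2$-frugal coloring of $G$ is a proper vertex coloring in which no color appears more than twice in the (open) neighborhood of any vertex; $\chi_2^f(G)$ is the minimum number of colors in a $2$-frugal coloring of $G$. *)

theory Defs
  imports Complex_Main "Graph_Theory.Pair_Digraph"
begin

text \<open>
  A finite simple graph is a \<^locale>\<open>pair_graph\<close>: a finite, symmetric, loop-free set of ordered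
  pairs of vertices, each undirected edge being the two opposite arcs. The definitions below are
  meant for such graphs only. The graph without vertices is not excluded.
\<close>

definition neighbors :: "'a pair_pre_digraph \<Rightarrow> 'a \<Rightarrow> 'a set" where
  "neighbors G v = {u. (v, u) \<in> parcs G}"

definition triangle_free :: "'a pair_pre_digraph \<Rightarrow> bool" where
  "triangle_free G \<longleftrightarrow>
     \<not> (\<exists>u v w. (u, v) \<in> parcs G \<and> (v, w) \<in> parcs G \<and> (w, u) \<in> parcs G)"

definition independent_set :: "'a pair_pre_digraph \<Rightarrow> 'a set \<Rightarrow> bool" where
  "independent_set G S \<longleftrightarrow> S \<subseteq> pverts G \<and> (\<forall>u\<in>S. \<forall>v\<in>S. (u, v) \<notin> parcs G)"

definition frugal2_independent_set :: "'a pair_pre_digraph \<Rightarrow> 'a set \<Rightarrow> bool" where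
  "frugal2_independent_set G S \<longleftrightarrow>
     independent_set G S \<and> (\<forall>v\<in>pverts G. card (neighbors G v \<inter> S) \<le> 2)"

definition frugal2_independence_number :: "'a pair_pre_digraph \<Rightarrow> nat" where
  "frugal2_independence_number G = Max (card ` {S. frugal2_independent_set G S})"

definition proper_coloring :: "'a pair_pre_digraph \<Rightarrow> ('a \<Rightarrow> nat) \<Rightarrow> bool" where
  "proper_coloring G c \<longleftrightarrow> (\<forall>u v. (u, v) \<in> parcs G \<longrightarrow> c u \<noteq> c v)"

definition frugal2_coloring :: "'a pair_pre_digraph \<Rightarrow> ('a \<Rightarrow> nat) \<Rightarrow> bool" where
  "frugal2_coloring G c \<longleftrightarrow>
     proper_coloring G c \<and> (\<forall>v\<in>pverts G. \<forall>i. card {u \<in> neighbors G v. c u = i} \<le> 2)"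

definition frugal2_chromatic_number :: "'a pair_pre_digraph \<Rightarrow> nat" where
  "frugal2_chromatic_number G = (LEAST k. \<exists>c. frugal2_coloring G c \<and> card (c ` pverts G) = k)"

text \<open>The maximum and the minimum above exist.\<close>

lemma frugal2_independence_number_attained:
  assumes "pair_graph G"
  shows "\<exists>S. frugal2_independent_set G S \<and> card S = frugal2_independence_number G"
    and "frugal2_independent_set G S \<Longrightarrow> card S \<le> frugal2_independence_number G"
proof -
  interpret pair_graph G by fact
  let ?F = "{S. frugal2_independent_set G S}"
  have "?F \<subseteq> Pow (pverts G)"
    by (auto simp: frugal2_independent_set_def independent_set_def)
  then have fin: "finite ?F"
    by (rule finite_subset) simp
  have "{} \<in> ?F"
    by (simp add: frugal2_independent_set_def independent_set_def)
  then have "Max (card ` ?F) \<in> card ` ?F"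
    using fin by (intro Max_in) auto
  then show "\<exists>S. frugal2_independent_set G S \<and> card S = frugal2_independence_number G"
    by (auto simp: frugal2_independence_number_def)
  show "card S \<le> frugal2_independence_number G" if "frugal2_independent_set G S"
    unfolding frugal2_independence_number_def using fin that by (intro Max_ge) auto
qed

lemma frugal2_chromatic_number_attained:
  assumes "pair_graph G"
  shows "\<exists>c. frugal2_coloring G c \<and> card (c ` pverts G) = frugal2_chromatic_number G"
    and "frugal2_coloring G c \<Longrightarrow> frugal2_chromatic_number G \<le> card (c ` pverts G)"
proof -
  interpret pair_graph G by fact
  obtain c :: "'a \<Rightarrow> nat" where inj: "inj_on c (pverts G)"
    using finite_imp_inj_to_nat_seg[of "pverts G"] by auto
  have arc: "u \<in> pverts G \<and> v \<in> pverts G \<and> u \<noteq> v" if "(u, v) \<in> parcs G" for u v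
    using that in_arcsD1 in_arcsD2 no_loops by fastforce
  have "card {u \<in> neighbors G v. c u = i} \<le> 2" for v i
  proof -
    have "\<exists>x. {u \<in> neighbors G v. c u = i} \<subseteq> {x}"
      using arc inj unfolding neighbors_def inj_on_def by blast
    then obtain x where "{u \<in> neighbors G v. c u = i} \<subseteq> {x}" ..
    from card_mono[OF _ this] show ?thesis by simp
  qed
  moreover have "proper_coloring G c"
    using arc inj unfolding proper_coloring_def inj_on_def by blast
  ultimately have "\<exists>k c. frugal2_coloring G c \<and> card (c ` pverts G) = k"
    by (auto simp: frugal2_coloring_def)
  then show "\<exists>c. frugal2_coloring G c \<and> card (c ` pverts G) = frugal2_chromatic_number G"
    unfolding frugal2_chromatic_number_def by (rule LeastI_ex)
  show "frugal2_chromatic_number G \<le> card (c ` pverts G)" if "frugal2_coloring G c" for c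
    unfolding frugal2_chromatic_number_def using that by (intro Least_le) auto
qed

end

theory Submission
  imports Defs
begin

text \<open>
  Give one colour to a maximum 2-frugal independent set \<open>S\<close>; frugality of \<open>S\<close> is exactly what this
  colour class has to satisfy. On the remaining \<open>m = n - \<alpha>\<close> vertices use only colour classes with
  one or two vertices, for which frugality is automatic. Pair off non-adjacent vertices for as long
  as possible: the vertices that stay unpaired form a clique, so there are at most two of them when
  there is no triangle, and at most \<open>\<lfloor>m / 2\<rfloor> + 1\<close> colours are spent
  (\<open>coloring_with_classes_of_size_at_most_2\<close>). The total is \<open>\<lfloor>m / 2\<rfloor> + 2 = \<lfloor>(n - \<alpha> + 4) / 2\<rfloor>\<close>.

  The complete graph on two vertices is extremal: it needs two colours, while \<open>n = 2\<close> and
  \<open>\<alpha> \<ge> 1\<close> force the bound down to \<open>\<lfloor>5 / 2\<rfloor> = 2\<close>.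
\<close>

text \<open>
  Induction removing a non-adjacent pair, which costs one new colour and lowers the cardinality
  by two. It stops at a clique, where every vertex gets its own colour; the summand \<open>1\<close> covers
  the cliques with one and two vertices.
\<close>
lemma coloring_with_classes_of_size_at_most_2:
  fixes E :: "'a rel"
  assumes "finite H" and "sym E" and "irrefl E"
    and no_triangle: "\<And>u v w. (u, v) \<in> E \<Longrightarrow> (v, w) \<in> E \<Longrightarrow> (w, u) \<notin> E"
  shows "\<exists>c :: 'a \<Rightarrow> nat. (\<forall>u\<in>H. \<forall>v\<in>H. (u, v) \<in> E \<longrightarrow> c u \<noteq> c v) \<and>
           (\<forall>i. card {u \<in> H. c u = i} \<le> 2) \<and> card (c ` H) \<le> card H div 2 + 1"
  using \<open>finite H\<close>
proof (induction H rule: finite_psubset_induct)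
  case (psubset H)
  show ?case
  proof (cases "\<exists>x\<in>H. \<exists>y\<in>H. x \<noteq> y \<and> (x, y) \<notin> E")
    case True
    then obtain x y where xy: "x \<in> H" "y \<in> H" "x \<noteq> y" "(x, y) \<notin> E" by blast
    then have yx: "(y, x) \<notin> E" using \<open>sym E\<close> by (meson symD)
    define H' where "H' = H - {x, y}"
    have "H' \<subset> H" using xy by (auto simp: H'_def)
    from psubset.IH[OF this] obtain c :: "'a \<Rightarrow> nat"
      where proper: "\<forall>u\<in>H'. \<forall>v\<in>H'. (u, v) \<in> E \<longrightarrow> c u \<noteq> c v"
        and small: "\<forall>i. card {u \<in> H'. c u = i} \<le> 2"
        and few: "card (c ` H') \<le> card H' div 2 + 1"
      by blast
    have fin: "finite H'" using psubset.hyps by (simp add: H'_def)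
    obtain k where k: "k \<notin> c ` H'"
      using ex_new_if_finite[OF infinite_UNIV_nat finite_imageI[OF fin]] by blast
    define d where "d u = (if u = x \<or> u = y then k else c u)" for u
    have "\<forall>u\<in>H. \<forall>v\<in>H. (u, v) \<in> E \<longrightarrow> d u \<noteq> d v"
      using proper k xy yx irreflD[OF \<open>irrefl E\<close>] by (auto simp: d_def H'_def)
    moreover have "card {u \<in> H. d u = i} \<le> 2" for i
    proof (cases "i = k")
      case True
      then have "{u \<in> H. d u = i} = {x, y}"
        using k xy by (auto simp: d_def H'_def)
      then show ?thesis using xy by simp
    next
      case False
      then have "{u \<in> H. d u = i} = {u \<in> H'. c u = i}"
        by (auto simp: d_def H'_def)
      then show ?thesis using small by simp
    qed
    moreover have "card (d ` H) \<le> card H div 2 + 1"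
    proof -
      have "d ` H \<subseteq> insert k (c ` H')" by (auto simp: d_def H'_def)
      then have "card (d ` H) \<le> card (insert k (c ` H'))"
        using fin by (intro card_mono) auto
      also have "\<dots> \<le> Suc (card (c ` H'))"
        by (rule card_insert_le_m1) auto
      also have "\<dots> \<le> (card H' + 2) div 2 + 1" using few by simp
      also have "card H' + 2 = card H"
      proof -
        have "H = insert x (insert y H')" "x \<notin> insert y H'" "y \<notin> H'"
          using xy by (auto simp: H'_def)
        then show ?thesis using fin by simp
      qed
      finally show ?thesis .
    qed
    ultimately show ?thesis by blast
  next
    case False
    then have clique: "(x, y) \<in> E" if "x \<in> H" "y \<in> H" "x \<noteq> y" for x y
      using that by blast
    have small: "card H \<le> 2"
    proof (rule ccontr)
      assume "\<not> card H \<le> 2"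
      then have "3 \<le> card H" by simp
      then obtain T where "T \<subseteq> H" "card T = 3"
        by (meson obtain_subset_with_card_n)
      then obtain u v w where "u \<in> H" "v \<in> H" "w \<in> H" "u \<noteq> v" "v \<noteq> w" "w \<noteq> u"
        by (auto simp: card_3_iff)
      with clique no_triangle show False by blast
    qed
    obtain c :: "'a \<Rightarrow> nat" where inj: "inj_on c H"
      using finite_imp_inj_to_nat_seg[OF psubset.hyps] by auto
    have "\<forall>u\<in>H. \<forall>v\<in>H. (u, v) \<in> E \<longrightarrow> c u \<noteq> c v"
      using inj irreflD[OF \<open>irrefl E\<close>] by (auto dest: inj_onD)
    moreover have "card {u \<in> H. c u = i} \<le> 2" for i
      using card_mono[OF psubset.hyps, of "{u \<in> H. c u = i}"] small by auto
    moreover have "card (c ` H) \<le> card H div 2 + 1"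
      using small by (simp add: card_image[OF inj])
    ultimately show ?thesis by blast
  qed
qed

lemma frugal2_chromatic_number_le:
  assumes "pair_graph G" and "triangle_free G"
  shows "frugal2_chromatic_number G
           \<le> (card (pverts G) - frugal2_independence_number G) div 2 + 2"
proof -
  interpret pair_graph G by fact
  obtain S where S: "frugal2_independent_set G S" and card_S: "card S = frugal2_independence_number G"
    using frugal2_independence_number_attained(1)[OF \<open>pair_graph G\<close>] by blast
  have sub: "S \<subseteq> pverts G" and indep: "\<And>u v. u \<in> S \<Longrightarrow> v \<in> S \<Longrightarrow> (u, v) \<notin> parcs G"
    and frugal: "\<And>v. v \<in> pverts G \<Longrightarrow> card (neighbors G v \<inter> S) \<le> 2"
    using S by (auto simp: frugal2_independent_set_def independent_set_def)
  have arc: "u \<in> pverts G \<and> v \<in> pverts G \<and> u \<noteq> v" if "(u, v) \<in> parcs G" for u v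
    using that in_arcsD1 in_arcsD2 no_loops by fastforce
  then have nbr: "neighbors G v \<subseteq> pverts G" for v
    by (auto simp: neighbors_def)
  define H where "H = pverts G - S"
  have fin: "finite H" by (simp add: H_def)
  have "irrefl (parcs G)" using arc by (blast intro: irreflI)
  moreover have "sym (parcs G)" using arcs_symmetric by (blast intro: symI)
  moreover have "(w, u) \<notin> parcs G" if "(u, v) \<in> parcs G" "(v, w) \<in> parcs G" for u v w
    using that \<open>triangle_free G\<close> unfolding triangle_free_def by blast
  ultimately obtain c :: "'a \<Rightarrow> nat"
    where proper: "\<forall>u\<in>H. \<forall>v\<in>H. (u, v) \<in> parcs G \<longrightarrow> c u \<noteq> c v"
      and small: "\<forall>i. card {u \<in> H. c u = i} \<le> 2"
      and few: "card (c ` H) \<le> card H div 2 + 1"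
    using coloring_with_classes_of_size_at_most_2[OF fin] by blast
  obtain k where k: "k \<notin> c ` H"
    using ex_new_if_finite[OF infinite_UNIV_nat finite_imageI[OF fin]] by blast
  define d where "d u = (if u \<in> S then k else c u)" for u
  have "proper_coloring G d"
    unfolding proper_coloring_def
  proof (intro allI impI)
    fix u v assume "(u, v) \<in> parcs G"
    then show "d u \<noteq> d v"
      using arc[of u v] indep[of u v] proper k by (auto simp: d_def H_def)
  qed
  moreover have "card {u \<in> neighbors G v. d u = i} \<le> 2" if "v \<in> pverts G" for v i
  proof (cases "i = k")
    case True
    then have "{u \<in> neighbors G v. d u = i} = neighbors G v \<inter> S"
      using k nbr[of v] by (auto simp: d_def H_def)
    then show ?thesis using frugal[OF that] by simp
  next
    case False
    then have "{u \<in> neighbors G v. d u = i} \<subseteq> {u \<in> H. c u = i}"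
      using nbr[of v] by (auto simp: d_def H_def)
    then have "card {u \<in> neighbors G v. d u = i} \<le> card {u \<in> H. c u = i}"
      using fin by (intro card_mono) auto
    then show ?thesis using small le_trans by blast
  qed
  ultimately have "frugal2_coloring G d" by (simp add: frugal2_coloring_def)
  then have "frugal2_chromatic_number G \<le> card (d ` pverts G)"
    by (rule frugal2_chromatic_number_attained(2)[OF \<open>pair_graph G\<close>])
  also have "\<dots> \<le> card (insert k (c ` H))"
    using fin by (intro card_mono) (auto simp: d_def H_def)
  also have "\<dots> \<le> Suc (card (c ` H))"
    by (rule card_insert_le_m1) auto
  also have "\<dots> \<le> card H div 2 + 2" using few by simp
  also have "card H = card (pverts G) - frugal2_independence_number G"
    using sub card_S finite_subset[OF sub] by (simp add: H_def card_Diff_subset)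
  finally show ?thesis .
qed

lemma frugal2_chromatic_number_le_floor:
  assumes "pair_graph G" and "triangle_free G"
  shows "int (frugal2_chromatic_number G)
           \<le> \<lfloor>(real (card (pverts G)) - real (frugal2_independence_number G) + 4) / 2\<rfloor>"
proof -
  interpret pair_graph G by fact
  have "frugal2_independence_number G \<le> card (pverts G)"
    using frugal2_independence_number_attained(1)[OF \<open>pair_graph G\<close>]
    by (metis card_mono finite_verts frugal2_independent_set_def independent_set_def
        with_proj_simps(1))
  with frugal2_chromatic_number_le[OF assms]
  have "2 * frugal2_chromatic_number G + frugal2_independence_number G \<le> card (pverts G) + 4"
    by linarith
  then have "real (2 * frugal2_chromatic_number G + frugal2_independence_number G)
               \<le> real (card (pverts G) + 4)"
    by (rule of_nat_mono)
  then show ?thesis by (simp add: le_floor_iff)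
qed

definition K2 :: "nat pair_pre_digraph" where
  "K2 = \<lparr>pverts = {0, 1}, parcs = {(0, 1), (1, 0)}\<rparr>"

lemma pair_graph_K2: "pair_graph K2"
  by unfold_locales (auto simp: K2_def sym_def arc_to_ends_def symmetric_def)

lemma triangle_free_K2: "triangle_free K2"
  by (auto simp: triangle_free_def K2_def)

lemma frugal2_chromatic_number_K2_ge: "2 \<le> frugal2_chromatic_number K2"
proof -
  obtain c where "frugal2_coloring K2 c" and k: "card (c ` pverts K2) = frugal2_chromatic_number K2"
    using frugal2_chromatic_number_attained(1)[OF pair_graph_K2] by blast
  then have "c 0 \<noteq> c 1"
    by (auto simp: frugal2_coloring_def proper_coloring_def K2_def)
  then have "card (c ` pverts K2) = 2" by (simp add: K2_def)
  with k show ?thesis by simp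
qed

lemma frugal2_independence_number_K2_ge: "1 \<le> frugal2_independence_number K2"
proof -
  have "card (neighbors K2 v \<inter> {0}) \<le> 2" for v
    using card_mono[of "{0}" "neighbors K2 v \<inter> {0}"] by simp
  then have "frugal2_independent_set K2 {0}"
    by (simp add: frugal2_independent_set_def independent_set_def) (simp add: K2_def)
  then show ?thesis
    using frugal2_independence_number_attained(2)[OF pair_graph_K2, of "{0}"] by simp
qed

lemma frugal2_chromatic_number_K2:
  "int (frugal2_chromatic_number K2)
     = \<lfloor>(real (card (pverts K2)) - real (frugal2_independence_number K2) + 4) / 2\<rfloor>"
proof (rule antisym)
  have "(real (card (pverts K2)) - real (frugal2_independence_number K2) + 4) / 2 < 3"
    using frugal2_independence_number_K2_ge by (simp add: K2_def)
  then have "\<lfloor>(real (card (pverts K2)) - real (frugal2_independence_number K2) + 4) / 2\<rfloor> < 3"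
    by (simp add: floor_less_iff)
  then show "\<lfloor>(real (card (pverts K2)) - real (frugal2_independence_number K2) + 4) / 2\<rfloor>
      \<le> int (frugal2_chromatic_number K2)"
    using frugal2_chromatic_number_K2_ge by linarith
qed (rule frugal2_chromatic_number_le_floor[OF pair_graph_K2 triangle_free_K2])

theorem proposition3p3:
  shows "(\<forall>(G :: 'a pair_pre_digraph) n. pair_graph G \<and> triangle_free G \<and> card (pverts G) = n \<longrightarrow>
            int (frugal2_chromatic_number G)
              \<le> \<lfloor>(real n - real (frugal2_independence_number G) + 4) / 2\<rfloor>)
       \<and> (\<exists>(G :: nat pair_pre_digraph) n. pair_graph G \<and> triangle_free G \<and> card (pverts G) = n \<and>
            int (frugal2_chromatic_number G)
              = \<lfloor>(real n - real (frugal2_independence_number G) + 4) / 2\<rfloor>)"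
  using frugal2_chromatic_number_le_floor pair_graph_K2 triangle_free_K2 frugal2_chromatic_number_K2
  by blast

end
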